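(* Let $f\in W^{1,p,q}(0,\infty)$ for some $p\in[1,\infty)$ and $q\in(1,\infty]$. Then $$|f(t)|^p\leqslant\bigl(1+p\,\|f\|_{\infty}^{p-1}\,\|f'\|_{q}\bigr)\,S(t)^{(q-1)/(2q-1)}\quad\text{for all } t\geqslant 0,$$ where $S(t)=\int_t^{\infty}|f(\tau)|^p\,\mathrm{d}\tau$.
   Context: $W^{1,p,q}(0,\infty)=\{f \mid f\in L^p(0,\infty)\text{ and } f'\in L^q(0,\infty)\}$ denotes the "mixed Sobolev space" of real-valued functions. Here $f'$ is understood in the sense of distributions or, equivalently, in the sense that $f$ (after identification with its continuous representative) is locally absolutely continuous and $f'$ is its almost everywhere existing derivative. Each $f\in W^{1,p,q}(0,\infty)$ is identified with its continuous representative, extended continuously to $[0,\infty)$. Such functions are bounded, so $\|f\|_\infty=\sup_{t\geqslant 0}|f(t)|<\infty$; $\|\cdot\|_q$ is the norm of $L^q(0,\infty)$. Conventions: for $q=\infty$ the quotient $(q-1)/q$ is read as $1$ and accordingly $(q-1)/(2q-1)$ is read as $1/2$; for $p=1$ the factor $\|f\|_\infty^{p-1}$ is read as $1$. *)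

theory Defs
  imports "HOL-Analysis.Analysis" "HOL-Probability.Essential_Supremum"
begin

text \<open>Exponents live in \<^typ>\<open>ereal\<close>, so that \<open>\<infinity>\<close> is allowed.  Functions are not identified up to null
  sets: membership in \<open>L\<^sup>p\<close> is a predicate on representatives.\<close>

definition in_Lp :: "ereal \<Rightarrow> 'a measure \<Rightarrow> ('a \<Rightarrow> real) \<Rightarrow> bool" where
  "in_Lp p M f \<longleftrightarrow> f \<in> borel_measurable M \<and>
     (if p = \<infinity> then esssup M (\<lambda>x. ereal \<bar>f x\<bar>) < \<infinity>
      else integrable M (\<lambda>x. \<bar>f x\<bar> powr real_of_ereal p))"

definition Lp_norm :: "ereal \<Rightarrow> 'a measure \<Rightarrow> ('a \<Rightarrow> real) \<Rightarrow> real" where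
  "Lp_norm p M f =
     (if p = \<infinity> then real_of_ereal (esssup M (\<lambda>x. ereal \<bar>f x\<bar>))
      else (LINT x|M. \<bar>f x\<bar> powr real_of_ereal p) powr (1 / real_of_ereal p))"

text \<open>The usual \<open>\<epsilon>\<close>-\<open>\<delta>\<close> definition. A finite family of non-overlapping compact intervals is expressed
  by \<^const>\<open>division_of\<close>: its members are nonempty intervals \<open>K = {Inf K..Sup K}\<close> with pairwise
  disjoint interiors, contained in \<open>S\<close> but not required to cover it.\<close>

definition absolutely_continuous_on :: "real set \<Rightarrow> (real \<Rightarrow> real) \<Rightarrow> bool" where
  "absolutely_continuous_on S f \<longleftrightarrow>
     (\<forall>\<epsilon>>0. \<exists>\<delta>>0. \<forall>D T. D division_of T \<and> T \<subseteq> S \<and> (\<Sum>K\<in>D. Sup K - Inf K) < \<delta> \<longrightarrow>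
        (\<Sum>K\<in>D. \<bar>f (Sup K) - f (Inf K)\<bar>) < \<epsilon>)"

definition locally_absolutely_continuous_on :: "real set \<Rightarrow> (real \<Rightarrow> real) \<Rightarrow> bool" where
  "locally_absolutely_continuous_on S f \<longleftrightarrow>
     (\<forall>a b. {a..b} \<subseteq> S \<longrightarrow> absolutely_continuous_on {a..b} f)"

text \<open>The distributional derivative on an open set, described through the continuous representative
  \<open>f\<close>: local absolute continuity together with an almost everywhere existing derivative, of which
  \<open>f'\<close> is any representative.\<close>

definition has_weak_derivative_on :: "(real \<Rightarrow> real) \<Rightarrow> (real \<Rightarrow> real) \<Rightarrow> real set \<Rightarrow> bool" where
  "has_weak_derivative_on f f' S \<longleftrightarrow>
     locally_absolutely_continuous_on S f \<and>
     (AE t in lebesgue_on S. (f has_real_derivative f' t) (at t))"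

text \<open>The elements of \<open>W\<^sup>1\<^sup>,\<^sup>p\<^sup>,\<^sup>q(0,\<infinity>)\<close>, each given by its continuous representative, extended
  continuously to \<open>0\<close>. Values at negative arguments are irrelevant.\<close>

definition mixed_sobolev :: "ereal \<Rightarrow> ereal \<Rightarrow> (real \<Rightarrow> real) set" where
  "mixed_sobolev p q =
     {f. continuous_on {0..} f \<and> in_Lp p (lebesgue_on {0<..}) f \<and>
         (\<exists>f'. has_weak_derivative_on f f' {0<..} \<and> in_Lp q (lebesgue_on {0<..}) f')}"

text \<open>Members of \<^const>\<open>mixed_sobolev\<close> are bounded on \<open>{0..}\<close>; for an unbounded function this
  real-valued supremum would be meaningless.\<close>

definition sup_norm :: "(real \<Rightarrow> real) \<Rightarrow> real" where
  "sup_norm f = (SUP t\<in>{0..}. \<bar>f t\<bar>)"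

text \<open>The factor \<open>\<parallel>f\<parallel>\<^sub>\<infinity>\<^sup>p\<^sup>-\<^sup>1\<close>, read as \<open>1\<close> for \<open>p = 1\<close>; the case distinction is needed
  because \<open>0 powr 0 = 0\<close>.\<close>

definition sup_norm_factor :: "real \<Rightarrow> (real \<Rightarrow> real) \<Rightarrow> real" where
  "sup_norm_factor p f = (if p = 1 then 1 else sup_norm f powr (p - 1))"

text \<open>\<open>(q - 1) / (2 q - 1)\<close>, read as \<open>1 / 2\<close> for \<open>q = \<infinity>\<close>.\<close>

definition decay_exponent :: "ereal \<Rightarrow> real" where
  "decay_exponent q =
     (if q = \<infinity> then 1 / 2 else (real_of_ereal q - 1) / (2 * real_of_ereal q - 1))"

definition tail_integral :: "real \<Rightarrow> (real \<Rightarrow> real) \<Rightarrow> real \<Rightarrow> real" where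
  "tail_integral p f t = (LINT \<tau>:{t..}|lebesgue. \<bar>f \<tau>\<bar> powr p)"

end

theory Submission
  imports Defs
begin

text \<open>Put \<open>b = 1 - 1 / q\<close>, \<open>C = \<parallel>f'\<parallel>\<^sub>q\<close>. The fundamental theorem of calculus for absolutely continuous
  functions and Hoelder's inequality give \<open>\<bar>f t - f s\<bar> \<le> C (t - s)\<^sup>b\<close> for \<open>s \<le> t\<close>. With the mean value theorem
  for \<open>x \<mapsto> x\<^sup>p\<close> this becomes \<open>\<bar>f t\<bar>\<^sup>p \<le> \<bar>f s\<bar>\<^sup>p + L (s - t)\<^sup>b\<close> for \<open>t \<le> s\<close>, where \<open>L = p \<parallel>f\<parallel>\<^sub>\<infinity>\<^sup>p\<^sup>-\<^sup>1 C\<close>. Integrating over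
  \<open>s \<in> [t, t + h]\<close> yields \<open>h (\<bar>f t\<bar>\<^sup>p - L h\<^sup>b) \<le> S t\<close>, and \<open>h = S t\<close> to the power \<open>1 / (1 + b)\<close> gives the claim,
  since \<open>b / (1 + b) = (q - 1) / (2 q - 1)\<close>.\<close>

section \<open>Fundamental theorem of calculus for absolutely continuous functions\<close>

text \<open>The gauge on the exceptional null set confines the intervals tagged there to an open set of
  small measure, on which absolute continuity controls the increments of \<open>f\<close>.\<close>

lemma absolutely_continuous_FTC:
  assumes ac: "absolutely_continuous_on {a..b} f" and "a \<le> b" and "negligible N"
    and der: "\<And>x. x \<in> {a..b} - N \<Longrightarrow> (f has_real_derivative f' x) (at x)"
  shows "(f' has_integral f b - f a) {a..b}"
proof (cases "a = b")
  case True
  then show ?thesis by auto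
next
  case False
  with \<open>a \<le> b\<close> have "a < b" by simp
  \<comment> \<open>Zeroing the integrand on \<open>N\<close> makes a tag in \<open>N\<close>
    contribute only its increment of \<open>f\<close>. The spike rule returns to \<open>f'\<close>
    at the end.\<close>
  define g where "g x = (if x \<in> N then 0 else f' x)" for x
  have "(g has_integral f b - f a) {a..b}"
    unfolding has_integral_factor_content_real
  proof (intro allI impI)
    fix e :: real
    assume "e > 0"
    \<comment> \<open>The admissible error is \<open>e * (b - a)\<close>. One half is spent on tags
      in \<open>N\<close>, the other on the remaining tags.\<close>
    define \<epsilon> where "\<epsilon> = e / 2 * (b - a)"
    have "\<epsilon> > 0" using \<open>e > 0\<close> \<open>a < b\<close> by (simp add: \<epsilon>_def)
    then obtain \<delta> where "\<delta> > 0"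
      and \<delta>: "\<And>D T. D division_of T \<Longrightarrow> T \<subseteq> {a..b} \<Longrightarrow> (\<Sum>K\<in>D. Sup K - Inf K) < \<delta> \<Longrightarrow>
                (\<Sum>K\<in>D. \<bar>f (Sup K) - f (Inf K)\<bar>) < \<epsilon>"
      using ac unfolding absolutely_continuous_on_def by metis
    have Nnull: "N \<in> null_sets lebesgue"
      using \<open>negligible N\<close> by (simp add: negligible_iff_null_sets)
    then obtain U where "open U" "N \<subseteq> U" "U - N \<in> lmeasurable"
      and UN: "emeasure lebesgue (U - N) < ennreal \<delta>"
      using sets_lebesgue_outer_open[of N \<delta>] \<open>\<delta> > 0\<close> by blast
    have eU: "emeasure lebesgue U < ennreal \<delta>"
      using UN emeasure_Diff_null_set[OF Nnull, of U] \<open>open U\<close> by auto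
    then have U: "U \<in> lmeasurable"
      using \<open>open U\<close> by (intro fmeasurableI) (auto simp: less_top[symmetric] dest: less_trans)
    then have mU: "measure lebesgue U < \<delta>"
      using eU \<open>\<delta> > 0\<close> by (simp add: emeasure_eq_measure2 ennreal_less_iff)
    have "\<exists>d>0. \<forall>y. \<bar>y - x\<bar> < d \<longrightarrow> \<bar>f y - f x - f' x * (y - x)\<bar> \<le> e / 2 * \<bar>y - x\<bar>"
      if "x \<in> {a..b} - N" for x
    proof -
      have "\<forall>e>0. \<exists>d>0. \<forall>y. \<bar>y - x\<bar> < d \<longrightarrow> \<bar>f y - f x - f' x * (y - x)\<bar> \<le> e * \<bar>y - x\<bar>"
        using der[OF that] unfolding has_field_derivative_def has_derivative_at_alt by simp
      then show ?thesis using \<open>e > 0\<close> by (meson half_gt_zero)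
    qed
    then obtain d where d0: "\<And>x. x \<in> {a..b} - N \<Longrightarrow> d x > 0"
      and d: "\<And>x y. x \<in> {a..b} - N \<Longrightarrow> \<bar>y - x\<bar> < d x \<Longrightarrow>
                \<bar>f y - f x - f' x * (y - x)\<bar> \<le> e / 2 * \<bar>y - x\<bar>"
      by metis
    define \<gamma> where "\<gamma> x = (if x \<in> N then U else if x \<in> {a..b} then ball x (d x) else UNIV)" for x
    have "gauge \<gamma>"
      using \<open>open U\<close> \<open>N \<subseteq> U\<close> d0 unfolding gauge_def \<gamma>_def by auto
    moreover have "norm ((\<Sum>(x, K)\<in>P. measure lborel K *\<^sub>R g x) - (f b - f a)) \<le> e * measure lborel {a..b}"
      if P: "P tagged_division_of {a..b}" and fine: "\<gamma> fine P" for P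
    proof -
      define R where "R = {z \<in> P. fst z \<in> N}"
      have "finite P" using P by (rule tagged_division_ofD(1))
      have K: "\<exists>u v. u \<le> v \<and> K = {u..v} \<and> x \<in> {u..v} \<and> K \<subseteq> {a..b} \<and> K \<subseteq> \<gamma> x"
        if xK: "(x, K) \<in> P" for x K
      proof -
        obtain u v where "K = cbox u v" using tagged_division_ofD(4)[OF P xK] by blast
        moreover have "x \<in> K" "K \<subseteq> {a..b}" using tagged_division_ofD(2,3)[OF P xK] by auto
        moreover have "K \<subseteq> \<gamma> x" using fine xK unfolding fine_def by blast
        ultimately show ?thesis by (intro exI[of _ u] exI[of _ v]) auto
      qed
      have pd: "R tagged_partial_division_of {a..b}"
        using P tagged_partial_division_subset[of P "{a..b}" R]
        by (auto simp: R_def tagged_division_of_def)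
      have div: "snd ` R division_of \<Union>(snd ` R)"
        by (rule partial_division_of_tagged_division[OF pd])
      have sub: "\<Union>(snd ` R) \<subseteq> {a..b}" "\<Union>(snd ` R) \<subseteq> U"
        by (auto simp: R_def \<gamma>_def dest!: K)
      have "(\<Sum>K\<in>snd ` R. Sup K - Inf K) = (\<Sum>K\<in>snd ` R. measure lebesgue K)"
        by (intro sum.cong) (auto simp: R_def dest!: K)
      also have "\<dots> = measure lebesgue (\<Union>(snd ` R))"
        by (rule content_division[OF div])
      also have "\<dots> \<le> measure lebesgue U"
        using lmeasurable_division[OF div] U sub(2)
        by (intro measure_mono_fmeasurable) (auto simp: fmeasurable_def)
      finally have "(\<Sum>K\<in>snd ` R. \<bar>f (Sup K) - f (Inf K)\<bar>) < \<epsilon>"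
        using mU by (intro \<delta>[OF div sub(1)]) simp
      \<comment> \<open>Absolute continuity speaks of a set of intervals, the Riemann sum of tagged
        pairs. If two pairs share an interval, that interval has empty interior, so it is a single
        point and its increment vanishes.\<close>
      moreover have "(\<Sum>K\<in>snd ` R. \<bar>f (Sup K) - f (Inf K)\<bar>)
          = (\<Sum>z\<in>R. ((\<lambda>K. \<bar>f (Sup K) - f (Inf K)\<bar>) \<circ> snd) z)"
      proof (rule sum.reindex_nontrivial)
        show "finite R" using \<open>finite P\<close> by (simp add: R_def)
        fix z z'
        assume z: "z \<in> R" "z' \<in> R" "z \<noteq> z'" "snd z = snd z'"
        then have "interior (snd z) = {}"
          using tagged_partial_division_ofD(5)[OF pd] by (metis inf.idem prod.collapse)
        moreover have "(fst z, snd z) \<in> P" using z(1) by (simp add: R_def)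
        with K obtain u v where "u \<le> v" "snd z = {u..v}" by blast
        ultimately have "u = v" by simp
        then show "\<bar>f (Sup (snd z)) - f (Inf (snd z))\<bar> = 0"
          using \<open>snd z = {u..v}\<close> by simp
      qed
      ultimately have R: "(\<Sum>(x, K)\<in>R. \<bar>f (Sup K) - f (Inf K)\<bar>) < \<epsilon>" by (simp add: split_beta)
      let ?D = "\<lambda>z. measure lborel (snd z) * g (fst z) - (f (Sup (snd z)) - f (Inf (snd z)))"
      \<comment> \<open>The increments of \<open>f\<close> telescope to \<open>f b - f a\<close>
        over the division, so the total error splits into one error \<open>?D\<close> per
        pair.\<close>
      have eq: "(\<Sum>(x, K)\<in>P. measure lborel K *\<^sub>R g x) - (f b - f a) = (\<Sum>z\<in>P. ?D z)"
        using additive_tagged_division_1[OF \<open>a \<le> b\<close> P, of f, symmetric]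
        by (simp add: sum_subtractf split_beta)
      have "\<bar>\<Sum>z\<in>R. ?D z\<bar> \<le> (\<Sum>(x, K)\<in>R. \<bar>f (Sup K) - f (Inf K)\<bar>)"
        unfolding split_beta
        by (rule order.trans[OF sum_abs], rule sum_mono) (auto simp: R_def g_def)
      moreover have "\<bar>\<Sum>z\<in>P - R. ?D z\<bar> \<le> \<epsilon>"
      proof -
        have "\<bar>\<Sum>z\<in>P - R. ?D z\<bar> \<le> (\<Sum>z\<in>P - R. e / 2 * (Sup (snd z) - Inf (snd z)))"
        proof (rule order.trans[OF sum_abs], rule sum_mono)
          fix z
          assume "z \<in> P - R"
          then obtain x C where z: "z = (x, C)" "(x, C) \<in> P" "x \<notin> N"
            by (cases z) (auto simp: R_def)
          with K obtain u v where uv: "u \<le> v" "C = {u..v}" "x \<in> {u..v}" "C \<subseteq> {a..b}" "C \<subseteq> \<gamma> x"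
            by blast
          then have x: "x \<in> {a..b} - N" using z by auto
          then have "C \<subseteq> ball x (d x)" using uv z by (simp add: \<gamma>_def)
          moreover have "u \<in> C" "v \<in> C" using uv by auto
          ultimately have "u \<in> ball x (d x)" "v \<in> ball x (d x)" by blast+
          then have "\<bar>u - x\<bar> < d x" "\<bar>v - x\<bar> < d x" by (auto simp: dist_real_def)
          from this[THEN d[OF x]]
          have "\<bar>f u - f x - f' x * (u - x)\<bar> \<le> e / 2 * (x - u)"
            "\<bar>f v - f x - f' x * (v - x)\<bar> \<le> e / 2 * (v - x)"
            using uv by auto
          \<comment> \<open>Straddling: the tag lies between \<open>u\<close> and \<open>v\<close>,
            so the linearisation errors at the two endpoints add up to a multiple of
            \<open>v - u\<close>.\<close>
          moreover have "(v - u) * f' x - (f v - f u) =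
              (f u - f x - f' x * (u - x)) - (f v - f x - f' x * (v - x))"
            by (simp add: algebra_simps)
          moreover have "e / 2 * (v - u) = e / 2 * (x - u) + e / 2 * (v - x)"
            by (simp add: field_simps)
          ultimately have "\<bar>(v - u) * f' x - (f v - f u)\<bar> \<le> e / 2 * (v - u)"
            by linarith
          then show "\<bar>?D z\<bar> \<le> e / 2 * (Sup (snd z) - Inf (snd z))"
            using uv z by (simp add: g_def)
        qed
        also have "\<dots> \<le> (\<Sum>z\<in>P. e / 2 * (Sup (snd z) - Inf (snd z)))"
          using \<open>finite P\<close> \<open>e > 0\<close> by (intro sum_mono2) (auto dest!: K)
        also have "\<dots> = \<epsilon>"
          using additive_tagged_division_1[OF \<open>a \<le> b\<close> P, of "\<lambda>x. x"]
          unfolding sum_distrib_left[symmetric] by (simp add: \<epsilon>_def split_beta)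
        finally show ?thesis .
      qed
      moreover have "(\<Sum>z\<in>P. ?D z) = (\<Sum>z\<in>P - R. ?D z) + (\<Sum>z\<in>R. ?D z)"
        using \<open>finite P\<close> by (intro sum.subset_diff) (auto simp: R_def)
      ultimately have "\<bar>\<Sum>z\<in>P. ?D z\<bar> \<le> \<epsilon> + \<epsilon>"
        using R by linarith
      then show ?thesis
        using eq \<open>a \<le> b\<close> by (simp add: \<epsilon>_def)
    qed
    ultimately show "\<exists>\<gamma>. gauge \<gamma> \<and> (\<forall>P. P tagged_division_of {a..b} \<and> \<gamma> fine P \<longrightarrow>
        norm ((\<Sum>(x, K)\<in>P. measure lborel K *\<^sub>R g x) - (f b - f a)) \<le> e * measure lborel {a..b})"
      by (intro exI[of _ \<gamma>] conjI allI impI) (assumption, elim conjE, assumption)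
  qed
  then show ?thesis
    by (rule has_integral_spike[OF \<open>negligible N\<close>, rotated]) (simp add: g_def)
qed

section \<open>Hoelder's inequality on a finite measure space\<close>

text \<open>This is Hoelder's inequality against the constant function 1. Young's inequality bounds
  \<open>\<bar>g x\<bar>\<close> by an affine function of \<open>\<bar>g x\<bar> powr q\<close>,
  which is integrable because the measure is finite.\<close>

lemma (in finite_measure) integral_abs_le_powr:
  assumes "1 < q" and [measurable]: "g \<in> borel_measurable M"
    and int: "integrable M (\<lambda>x. \<bar>g x\<bar> powr q)"
  shows "integrable M g"
    and "(LINT x|M. \<bar>g x\<bar>) \<le>
      (LINT x|M. \<bar>g x\<bar> powr q) powr (1 / q) * measure M (space M) powr (1 - 1 / q)"
proof -
  define I where "I = (LINT x|M. \<bar>g x\<bar> powr q)"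
  define m where "m = measure M (space M)"
  have "I \<ge> 0" unfolding I_def by simp
  have "m \<ge> 0" by (simp add: m_def)
  \<comment> \<open>Young's inequality with a free scale \<open>l\<close>, optimised below at \<open>l = (I / m)\<close> to the power \<open>1 / q\<close>.\<close>
  have young: "\<bar>g x\<bar> \<le> l * (\<bar>g x\<bar> powr q / (q * l powr q) + (1 - 1 / q))" if "l > 0" for l x
  proof -
    have "\<bar>g x\<bar> / l * 1 \<le> (\<bar>g x\<bar> / l) powr q / q + 1 powr (q / (q - 1)) / (q / (q - 1))"
      using \<open>1 < q\<close> that by (intro Youngs_inequality) (auto simp: field_simps)
    also have "\<dots> = \<bar>g x\<bar> powr q / (q * l powr q) + (1 - 1 / q)"
      using \<open>1 < q\<close> that by (simp add: powr_divide field_simps)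
    finally show ?thesis using that by (simp add: field_simps)
  qed
  show int1: "integrable M g"
  proof (rule Bochner_Integration.integrable_bound)
    show "integrable M (\<lambda>x. \<bar>g x\<bar> powr q / q + (1 - 1 / q))"
      using int by simp
    show "AE x in M. norm (g x) \<le> norm (\<bar>g x\<bar> powr q / q + (1 - 1 / q))"
      using young[of 1] by (intro AE_I2) (force intro: order.trans)
  qed simp
  have le: "(LINT x|M. \<bar>g x\<bar>) \<le> l * (I / (q * l powr q) + (1 - 1 / q) * m)" if "l > 0" for l
  proof -
    have "(LINT x|M. \<bar>g x\<bar>) \<le> (LINT x|M. l * (\<bar>g x\<bar> powr q / (q * l powr q) + (1 - 1 / q)))"
      using int int1 young[OF that] by (intro integral_mono) auto
    also have "\<dots> = l * (I / (q * l powr q) + (1 - 1 / q) * m)"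
      using int by (simp add: I_def m_def)
    finally show ?thesis .
  qed
  show "(LINT x|M. \<bar>g x\<bar>) \<le> I powr (1 / q) * m powr (1 - 1 / q)"
  \<comment> \<open>The optimal scale is positive only if neither quantity vanishes. Otherwise
    \<open>g\<close> is zero almost everywhere or the whole space is null.\<close>
  proof (cases "I = 0 \<or> m = 0")
    case True
    then show ?thesis
    proof
      assume "I = 0"
      then have "AE x in M. \<bar>g x\<bar> powr q = 0"
        unfolding I_def using int by (subst (asm) integral_nonneg_eq_0_iff_AE) auto
      then have "AE x in M. \<bar>g x\<bar> = 0" by eventually_elim simp
      then have "(LINT x|M. \<bar>g x\<bar>) = (LINT x|M. 0)"
        by (intro integral_cong_AE) auto
      then show ?thesis using \<open>I = 0\<close> by simp
    next
      assume "m = 0"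
      then have "space M \<in> null_sets M"
        by (simp add: m_def emeasure_eq_measure null_sets_def)
      then have "AE x in M. \<bar>g x\<bar> = 0"
        using AE_not_in[of "space M" M] by (auto elim: eventually_elim2[OF _ AE_space])
      then have "(LINT x|M. \<bar>g x\<bar>) = (LINT x|M. 0)"
        by (intro integral_cong_AE) auto
      then show ?thesis using \<open>m = 0\<close> by simp
    qed
  next
    case False
    with \<open>I \<ge> 0\<close> \<open>m \<ge> 0\<close> have pos: "I > 0" "m > 0" by auto
    define l where "l = (I / m) powr (1 / q)"
    have "l > 0" "l powr q = I / m"
      using pos \<open>1 < q\<close> by (auto simp: l_def powr_powr)
    \<comment> \<open>With \<open>l powr q = I / m\<close> the bracket in \<open>le\<close> becomes
      \<open>m / q + (1 - 1 / q) * m = m\<close>.\<close>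
    then have "(LINT x|M. \<bar>g x\<bar>) \<le> l * m"
      using le[of l] pos \<open>1 < q\<close> by (simp add: field_simps)
    also have "\<dots> = I powr (1 / q) * m powr (1 - 1 / q)"
      using pos by (simp add: l_def powr_divide powr_diff)
    finally show ?thesis .
  qed
qed

section \<open>Norms, representatives and uniqueness of the weak derivative\<close>

lemma Lp_norm_nonneg:
  assumes "emeasure M (space M) \<noteq> 0"
  shows "Lp_norm q M g \<ge> 0"
proof (cases "(\<lambda>x. ereal \<bar>g x\<bar>) \<in> borel_measurable M")
  case True
  have "0 = esssup M (\<lambda>x. 0 :: ereal)"
    using assms by (simp add: esssup_const)
  also have "\<dots> \<le> esssup M (\<lambda>x. ereal \<bar>g x\<bar>)"
    by (intro esssup_mono) auto
  finally show ?thesis by (simp add: Lp_norm_def real_of_ereal_pos)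
next
  \<comment> \<open>The essential supremum of a non-measurable function is the top element, which
    \<open>real_of_ereal\<close> maps to 0. For finite \<open>q\<close> the norm is a power and
    hence nonnegative.\<close>
  case False
  then show ?thesis by (simp add: Lp_norm_def esssup_non_measurable top_ereal_def)
qed

text \<open>Membership in \<open>mixed_sobolev\<close> provides some weak derivative in the right
  space, while the theorem is about a given one. This lemma transfers integrability between the
  two.\<close>

lemma in_Lp_cong_AE:
  fixes g h :: "real \<Rightarrow> real"
  assumes "S \<in> sets lebesgue" and g: "in_Lp q (lebesgue_on S) g"
    and ae: "AE x in lebesgue_on S. g x = h x"
  shows "in_Lp q (lebesgue_on S) h"
proof -
  have gm: "g \<in> borel_measurable (lebesgue_on S)" using g by (simp add: in_Lp_def)
  have hm: "h \<in> borel_measurable (lebesgue_on S)"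
  proof -
    \<comment> \<open>Extension by zero moves the question to the whole line, where completeness of
      Lebesgue measure makes the modified function measurable.\<close>
    have "AE x in lebesgue. indicator S x *\<^sub>R g x = indicator S x *\<^sub>R h x"
      using ae \<open>S \<in> sets lebesgue\<close>
      by (auto simp: AE_restrict_space_iff indicator_def elim!: eventually_mono)
    with borel_measurable_AE[of "\<lambda>x. indicator S x *\<^sub>R g x" "\<lambda>x. indicator S x *\<^sub>R h x"]
    show ?thesis
      using gm \<open>S \<in> sets lebesgue\<close> by (simp add: borel_measurable_restrict_space_iff)
  qed
  show ?thesis
  proof (cases "q = \<infinity>")
    case True
    have "esssup (lebesgue_on S) (\<lambda>x. ereal \<bar>h x\<bar>) = esssup (lebesgue_on S) (\<lambda>x. ereal \<bar>g x\<bar>)"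
      using gm hm ae by (intro esssup_AE_cong) (auto elim: eventually_mono)
    then show ?thesis using g hm True by (simp add: in_Lp_def)
  next
    case False
    have "integrable (lebesgue_on S) (\<lambda>x. \<bar>h x\<bar> powr real_of_ereal q)"
    proof (rule integrable_cong_AE_imp)
      show "integrable (lebesgue_on S) (\<lambda>x. \<bar>g x\<bar> powr real_of_ereal q)"
        using g False by (simp add: in_Lp_def)
      show "AE x in lebesgue_on S. \<bar>g x\<bar> powr real_of_ereal q = \<bar>h x\<bar> powr real_of_ereal q"
        using ae by eventually_elim simp
    qed (use hm in measurable)
    then show ?thesis using hm False by (simp add: in_Lp_def)
  qed
qed

lemma weak_derivative_unique_AE:
  assumes "has_weak_derivative_on f g S" "has_weak_derivative_on f h S"
  shows "AE x in lebesgue_on S. g x = h x"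
  using assms unfolding has_weak_derivative_on_def by (auto elim: eventually_elim2 dest: DERIV_unique)

section \<open>Hoelder continuity from the weak derivative\<close>

text \<open>For \<open>q = \<infinity>\<close> the exponent is \<open>1\<close>, because \<^const>\<open>real_of_ereal\<close> maps \<open>\<infinity>\<close> to \<open>0\<close> and \<open>1 / 0 = 0\<close>.\<close>

lemma weak_derivative_increment:
  assumes "1 < q" and wd: "has_weak_derivative_on f f' {0<..}"
    and Lq: "in_Lp q (lebesgue_on {0<..}) f'" and "0 < s" "s \<le> t"
  shows "\<bar>f t - f s\<bar> \<le> Lp_norm q (lebesgue_on {0<..}) f' * (t - s) powr (1 - 1 / real_of_ereal q)"
proof -
  let ?M = "lebesgue_on {s..t}"
  let ?N = "Lp_norm q (lebesgue_on {0<..}) f'"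
  have sub: "{s..t} \<subseteq> {0<..}" using \<open>0 < s\<close> by auto
  have fin: "finite_measure ?M" by (intro finite_measure_lebesgue_on) simp
  interpret finite_measure ?M by (rule fin)
  have mM: "measure ?M (space ?M) = t - s"
    using \<open>s \<le> t\<close> by (simp add: measure_restrict_space)
  have meas: "f' \<in> borel_measurable ?M"
    using Lq sub unfolding in_Lp_def by (auto intro: measurable_restrict_mono)
  have "AE x in lebesgue_on {0<..}. (f has_real_derivative f' x) (at x)"
    using wd by (simp add: has_weak_derivative_on_def)
  then have "AE x in lebesgue. x \<in> {0<..} \<longrightarrow> (f has_real_derivative f' x) (at x)"
    by (subst (asm) AE_restrict_space_iff) auto
  then obtain N where "N \<in> null_sets lebesgue"
    and N: "\<And>x. x \<in> {0<..} \<Longrightarrow> x \<notin> N \<Longrightarrow> (f has_real_derivative f' x) (at x)"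
    unfolding eventually_ae_filter by auto
  have FTC: "(f' has_integral f t - f s) {s..t}"
  proof (rule absolutely_continuous_FTC[of _ _ _ N])
    show "absolutely_continuous_on {s..t} f"
      using wd sub by (simp add: has_weak_derivative_on_def locally_absolutely_continuous_on_def)
    show "negligible N"
      using \<open>N \<in> null_sets lebesgue\<close> by (simp add: negligible_iff_null_sets)
    show "(f has_real_derivative f' x) (at x)" if "x \<in> {s..t} - N" for x
      using that N sub by blast
  qed fact
  have "integrable ?M f' \<and> (LINT x|?M. \<bar>f' x\<bar>) \<le> ?N * (t - s) powr (1 - 1 / real_of_ereal q)"
  proof (cases "q = \<infinity>")
    case True
    \<comment> \<open>\<open>real_of_ereal\<close> preserves only finite values.
      \<open>in_Lp\<close> excludes \<infinity> as essential supremum, and -\<infinity> cannot bound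
      an absolute value.\<close>
    have "AE x in lebesgue_on {0<..}. \<bar>f' x\<bar> \<le> ?N"
      using esssup_AE[of "\<lambda>x. ereal \<bar>f' x\<bar>" "lebesgue_on {0<..}"]
    proof eventually_elim
      case (elim x)
      have "esssup (lebesgue_on {0<..}) (\<lambda>x. ereal \<bar>f' x\<bar>) < \<infinity>"
        using Lq True by (simp add: in_Lp_def)
      then show ?case
        using elim True by (cases "esssup (lebesgue_on {0<..}) (\<lambda>x. ereal \<bar>f' x\<bar>)") (auto simp: Lp_norm_def)
    qed
    then have "AE x in lebesgue. x \<in> {0<..} \<longrightarrow> \<bar>f' x\<bar> \<le> ?N"
      by (subst (asm) AE_restrict_space_iff) auto
    then have "AE x in lebesgue. x \<in> {s..t} \<longrightarrow> \<bar>f' x\<bar> \<le> ?N"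
      by eventually_elim (use sub in blast)
    then have bound: "AE x in ?M. \<bar>f' x\<bar> \<le> ?N"
      by (subst AE_restrict_space_iff) auto
    have int: "integrable ?M f'"
      using bound meas by (intro integrable_const_bound[of f' ?N]) auto
    moreover have "(LINT x|?M. \<bar>f' x\<bar>) \<le> (LINT x|?M. ?N)"
      using bound int by (intro integral_mono_AE) auto
    ultimately show ?thesis
      using mM True \<open>s \<le> t\<close> by (auto simp: mult.commute)
  next
    case False
    then obtain r where r: "q = ereal r" "1 < r"
      using \<open>1 < q\<close> by (cases q) auto
    then have int0: "integrable (lebesgue_on {0<..}) (\<lambda>x. \<bar>f' x\<bar> powr r)"
      using Lq by (simp add: in_Lp_def)
    then have int: "integrable ?M (\<lambda>x. \<bar>f' x\<bar> powr r)"
      using sub set_integrable_subset[of lebesgue "{0<..}" "\<lambda>x. \<bar>f' x\<bar> powr r" "{s..t}"]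
      by (simp add: integrable_restrict_space set_integrable_def)
    have "(LINT x|?M. \<bar>f' x\<bar> powr r) \<le> (LINT x|lebesgue_on {0<..}. \<bar>f' x\<bar> powr r)"
      using int0 int sub
      by (auto simp: integral_restrict_space integrable_restrict_space indicator_def
          simp del: integral_indicator intro!: integral_mono)
    then have "(LINT x|?M. \<bar>f' x\<bar> powr r) powr (1 / r) \<le> ?N"
      using r by (auto simp: Lp_norm_def intro!: powr_mono2)
    then show ?thesis
      using integral_abs_le_powr[OF \<open>1 < r\<close> meas int] r mM
      by (auto elim!: order.trans intro!: mult_right_mono)
  qed
  \<comment> \<open>Integrability of \<open>f'\<close> on the interval identifies the gauge integral
    from \<open>FTC\<close> with the Lebesgue integral.\<close>
  moreover from this have "f t - f s = (LINT x|?M. f' x)"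
    using FTC by (subst lebesgue_integral_eq_integral) (auto simp: integral_unique)
  ultimately show ?thesis
    by (auto intro: order.trans[OF integral_abs_bound])
qed

text \<open>Absolute continuity is given only on compact subintervals of the open half-line, so the
  endpoint 0 is reached by letting \<open>s\<close> decrease to 0.\<close>

lemma weak_derivative_increment_closed:
  assumes "1 < q" and "has_weak_derivative_on f f' {0<..}"
    and "in_Lp q (lebesgue_on {0<..}) f'"
    and cont: "continuous_on {0..} f" and "0 \<le> s" "s \<le> t"
  shows "\<bar>f t - f s\<bar> \<le> Lp_norm q (lebesgue_on {0<..}) f' * (t - s) powr (1 - 1 / real_of_ereal q)"
proof (cases "s = 0 \<and> t > 0")
  case True
  let ?R = "\<lambda>s. Lp_norm q (lebesgue_on {0<..}) f' * (t - s) powr (1 - 1 / real_of_ereal q)"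
  have F: "at_right 0 \<le> at (0::real) within {0..}" by (intro at_le) auto
  have "(f \<longlongrightarrow> f 0) (at_right 0)"
    using cont F by (auto simp: continuous_on_def intro: tendsto_mono)
  then have "((\<lambda>s. \<bar>f t - f s\<bar>) \<longlongrightarrow> \<bar>f t - f 0\<bar>) (at_right 0)"
    by (intro tendsto_intros)
  \<comment> \<open>Here \<open>t > 0\<close> matters: the limit rule for \<open>powr\<close> asks
    for a nonzero limit of the base \<open>t - s\<close>.\<close>
  moreover have "(?R \<longlongrightarrow> ?R 0) (at_right 0)"
    using True by (intro tendsto_intros) auto
  moreover have "eventually (\<lambda>s. \<bar>f t - f s\<bar> \<le> ?R s) (at_right 0)"
    using eventually_at_right_less[of 0] eventually_at_right_real[of 0 t] True
    by (auto elim!: eventually_elim2 intro!: weak_derivative_increment assms)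
  ultimately show ?thesis
    using True by (intro tendsto_le[of "at_right 0" ?R _ "\<lambda>s. \<bar>f t - f s\<bar>"]) auto
next
  case False
  then show ?thesis
    using weak_derivative_increment[OF assms(1-3), of s t] assms(5,6) by (cases "s = t") auto
qed

section \<open>Pointwise bounds from the tail integral\<close>

text \<open>The integrand is nonnegative, so the tail dominates its part over a window. The decay
  estimate uses a window starting at \<open>t\<close> itself, with a \<open>c\<close> that may be
  negative. Boundedness uses a unit window anywhere in \<open>{0..}\<close>.\<close>

lemma tail_integral_lower_bound:
  assumes int: "set_integrable lebesgue {0..} (\<lambda>x. \<bar>f x\<bar> powr p)"
    and "0 \<le> t" "t \<le> a" "0 \<le> h" and c: "\<And>s. s \<in> {a..a + h} \<Longrightarrow> c \<le> \<bar>f s\<bar> powr p"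
  shows "h * c \<le> tail_integral p f t"
proof -
  have int1: "set_integrable lebesgue {t..} (\<lambda>x. \<bar>f x\<bar> powr p)"
    by (rule set_integrable_subset[OF int]) (use \<open>0 \<le> t\<close> in auto)
  have int2: "set_integrable lebesgue {a..a + h} (\<lambda>x. \<bar>f x\<bar> powr p)"
    by (rule set_integrable_subset[OF int]) (use \<open>0 \<le> t\<close> \<open>t \<le> a\<close> in auto)
  have "h * c = (LINT x:{a..a + h}|lebesgue. c)"
    using \<open>0 \<le> h\<close> by (subst set_integral_const) auto
  moreover have "set_integrable lebesgue {a..a + h} (\<lambda>x. c)"
    unfolding set_integrable_def by (subst integrable_restrict_space[symmetric]) auto
  ultimately have "h * c \<le> (LINT x:{a..a + h}|lebesgue. \<bar>f x\<bar> powr p)"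
    using int2 c by (simp only:) (rule set_integral_mono)
  also have "\<dots> \<le> tail_integral p f t"
    using int1 int2 \<open>t \<le> a\<close>
    unfolding tail_integral_def set_lebesgue_integral_def set_integrable_def
    by (intro integral_mono) (auto simp: indicator_def)
  finally show ?thesis .
qed

lemma decay_from_increment:
  assumes int: "set_integrable lebesgue {0..} (\<lambda>x. \<bar>f x\<bar> powr p)"
    and "0 \<le> t" "0 \<le> L" "0 < b"
    and inc: "\<And>s. t \<le> s \<Longrightarrow> \<bar>f t\<bar> powr p \<le> \<bar>f s\<bar> powr p + L * (s - t) powr b"
  shows "\<bar>f t\<bar> powr p \<le> (1 + L) * tail_integral p f t powr (b / (1 + b))"
proof -
  let ?S = "tail_integral p f t"
  have le: "h * (\<bar>f t\<bar> powr p - L * h powr b) \<le> ?S" if "h > 0" for h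
  proof (rule tail_integral_lower_bound[OF int \<open>0 \<le> t\<close> order_refl])
    fix s
    assume s: "s \<in> {t..t + h}"
    then have "L * (s - t) powr b \<le> L * h powr b"
      using \<open>0 < b\<close> \<open>0 \<le> L\<close> by (intro mult_left_mono powr_mono2) auto
    then show "\<bar>f t\<bar> powr p - L * h powr b \<le> \<bar>f s\<bar> powr p"
      using inc[of s] s by auto
  qed (use that in simp)
  have "?S \<ge> 0"
    unfolding tail_integral_def set_lebesgue_integral_def by (intro Bochner_Integration.integral_nonneg) auto
  show ?thesis
  proof (cases "?S = 0")
    \<comment> \<open>The optimal window would have length 0, so \<open>h\<close> is sent to 0
      instead, which makes the left-hand side vanish.\<close>
    case True
    have "\<bar>f t\<bar> powr p \<le> L * h powr b" if "h > 0" for h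
      using le[OF that] that True by (simp add: mult_le_0_iff)
    then have "\<bar>f t\<bar> powr p \<le> 0"
      using \<open>0 < b\<close>
      by (intro tendsto_lowerbound[of "\<lambda>h. L * h powr b" 0 "at_right 0"])
        (auto intro!: tendsto_eq_intros eventually_mono[OF eventually_at_right_less])
    with True show ?thesis by simp
  next
    case False
    with \<open>?S \<ge> 0\<close> have "?S > 0" by simp
    \<comment> \<open>This length solves \<open>?S / h = h powr b\<close>, so both terms of the
      bound are multiples of one power, with total factor \<open>1 + L\<close>.\<close>
    define h where "h = ?S powr (1 / (1 + b))"
    have "h > 0" using \<open>?S > 0\<close> by (simp add: h_def)
    have hb: "h powr b = ?S powr (b / (1 + b))"
      by (simp add: h_def powr_powr)
    have "?S / h = ?S powr (1 - 1 / (1 + b))"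
      using \<open>?S > 0\<close> by (simp add: h_def powr_diff)
    also have "1 - 1 / (1 + b) = b / (1 + b)"
      using \<open>0 < b\<close> by (simp add: field_simps)
    finally have "?S / h = h powr b" using hb by simp
    moreover have "\<bar>f t\<bar> powr p - L * h powr b \<le> ?S / h"
      using le[OF \<open>h > 0\<close>] \<open>h > 0\<close> by (simp add: pos_le_divide_eq mult.commute)
    ultimately have "\<bar>f t\<bar> powr p \<le> (1 + L) * h powr b"
      by (simp add: algebra_simps)
    then show ?thesis
by (simp only: hb)
  qed
qed

text \<open>By the mean value theorem the difference quotient is \<open>p * z powr (p - 1)\<close>
  with \<open>z < x\<close>, and this power increases in \<open>z\<close>. The case distinction
  matches \<open>sup_norm_factor\<close>, with which the bound is later compared.\<close>

lemma powr_diff_le: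
  fixes x y :: real
  assumes "1 \<le> p" "0 \<le> y" "y \<le> x"
  shows "x powr p - y powr p \<le> p * (if p = 1 then 1 else x powr (p - 1)) * (x - y)"
proof (cases "y = x")
  case False
  with assms have "y < x" by simp
  then obtain z where z: "y < z" "z < x" and eq: "x powr p - y powr p = p * z powr (p - 1) * (x - y)"
  proof (rule mvt)
    show "continuous_on {y..x} (\<lambda>x. x powr p)"
      using assms by (intro continuous_on_powr') (auto intro!: continuous_intros)
    show "((\<lambda>x. x powr p) has_derivative ((*) (p * z powr (p - 1)))) (at z)"
      if "y < z" for z
      using has_real_derivative_powr[of z p] that assms
      by (simp add: has_field_derivative_def)
  qed
  have "z powr (p - 1) \<le> (if p = 1 then 1 else x powr (p - 1))"
    using z assms by (auto intro: powr_mono2)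
  then show ?thesis
    using \<open>y < x\<close> \<open>1 \<le> p\<close> unfolding eq by (intro mult_right_mono mult_left_mono) auto
qed simp

text \<open>Over a unit interval to the right of \<open>t\<close>, \<open>f\<close> changes by at
  most \<open>C\<close>. A value far above \<open>C\<close> would therefore force a large integral.
  Boundedness is what makes \<open>sup_norm\<close> an actual upper bound.\<close>

lemma bounded_from_increment:
  fixes f :: "real \<Rightarrow> real"
  assumes int: "set_integrable lebesgue {0..} (\<lambda>x. \<bar>f x\<bar> powr p)"
    and "0 < p" "0 \<le> b" "0 \<le> C"
    and inc: "\<And>s t. 0 \<le> s \<Longrightarrow> s \<le> t \<Longrightarrow> \<bar>f t - f s\<bar> \<le> C * (t - s) powr b"
  shows "bdd_above ((\<lambda>t. \<bar>f t\<bar>) ` {0..})"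
proof (rule bdd_aboveI2)
  fix t :: real
  assume "t \<in> {0..}"
  then have "0 \<le> t" by simp
  show "\<bar>f t\<bar> \<le> C + tail_integral p f 0 powr (1 / p)"
  proof (cases "\<bar>f t\<bar> \<le> C")
    case True
    then show ?thesis by (simp add: add_increasing2)
  next
    case False
    have "1 * (\<bar>f t\<bar> - C) powr p \<le> tail_integral p f 0"
    proof (rule tail_integral_lower_bound[OF int order_refl \<open>0 \<le> t\<close>])
      fix s
      assume s: "s \<in> {t..t + 1}"
      have "(s - t) powr b \<le> 1"
        using s \<open>0 \<le> b\<close> by (intro powr_le1) auto
      then have "C * (s - t) powr b \<le> C"
        using \<open>0 \<le> C\<close> by (simp add: mult_left_le)
      then have "\<bar>f t\<bar> - C \<le> \<bar>f s\<bar>"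
        using inc[OF \<open>0 \<le> t\<close>, of s] s by auto
      then show "(\<bar>f t\<bar> - C) powr p \<le> \<bar>f s\<bar> powr p"
        using False \<open>0 < p\<close> by (intro powr_mono2) auto
    qed simp
    then have "((\<bar>f t\<bar> - C) powr p) powr (1 / p) \<le> tail_integral p f 0 powr (1 / p)"
      using \<open>0 < p\<close> by (intro powr_mono2) auto
    then show ?thesis
      using False \<open>0 < p\<close> by (simp add: powr_powr)
  qed
qed

section \<open>The decay estimate for mixed Sobolev functions\<close>

theorem corollary9:
  fixes f f' :: "real \<Rightarrow> real" and p :: real and q :: ereal
  assumes "1 \<le> p" and "1 < q"
    and "f \<in> mixed_sobolev (ereal p) q"
    and "has_weak_derivative_on f f' {0<..}"
  shows "\<forall>t\<ge>0. \<bar>f t\<bar> powr p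
           \<le> (1 + p * sup_norm_factor p f * Lp_norm q (lebesgue_on {0<..}) f')
              * tail_integral p f t powr decay_exponent q"
proof (intro allI impI)
  fix t :: real
  assume "t \<ge> 0"
  define b where "b = 1 - 1 / real_of_ereal q"
  have q: "q = \<infinity> \<or> (\<exists>r>1. q = ereal r)"
    using \<open>1 < q\<close> by (cases q) auto
  then have "b > 0" by (auto simp: b_def)
  \<comment> \<open>For finite \<open>q\<close> both sides are \<open>(q - 1) / (2 * q - 1)\<close>.
    For \<open>q = \<infinity>\<close>, \<open>b\<close> is 1 and both are
    \<open>1 / 2\<close>.\<close>
  have exp: "decay_exponent q = b / (1 + b)"
    using q by (auto simp: b_def decay_exponent_def field_simps)
  define C where "C = Lp_norm q (lebesgue_on {0<..}) f'"
  \<comment> \<open>The unit interval witnesses that the half-line has nonzero measure, as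
    \<open>Lp_norm_nonneg\<close> requires.\<close>
  have "emeasure lebesgue {0<..1::real} \<le> emeasure lebesgue {0::real<..}"
    by (intro emeasure_mono) auto
  then have "C \<ge> 0"
    unfolding C_def by (intro Lp_norm_nonneg) (auto simp: emeasure_restrict_space)
  obtain g where g: "has_weak_derivative_on f g {0<..}" "in_Lp q (lebesgue_on {0<..}) g"
    and cont: "continuous_on {0..} f" and f: "in_Lp (ereal p) (lebesgue_on {0<..}) f"
    using assms(3) unfolding mixed_sobolev_def by blast
  have Lq: "in_Lp q (lebesgue_on {0<..}) f'"
    using g(2) weak_derivative_unique_AE[OF g(1) assms(4)] by (rule in_Lp_cong_AE[rotated]) simp
  \<comment> \<open>Tail integrals may start at 0, so integrability is carried to the closed
    half-line by adding the null set \<open>{0}\<close>.\<close>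
  have "set_integrable lebesgue {0<..} (\<lambda>x. \<bar>f x\<bar> powr p)"
    using f by (simp add: in_Lp_def integrable_restrict_space set_integrable_def)
  moreover have "negligible {x \<in> {0..} - {0::real<..}. \<bar>f x\<bar> powr p \<noteq> 0}"
    by (rule negligible_subset[of "{0}"]) auto
  moreover have "negligible {x \<in> {0<..} - {0::real..}. \<bar>f x\<bar> powr p \<noteq> 0}"
    by (rule negligible_subset[of "{0}"]) auto
  ultimately have int: "set_integrable lebesgue {0..} (\<lambda>x. \<bar>f x\<bar> powr p)"
    using absolutely_integrable_spike_set_eq[of "{0..}" "{0<..}" "\<lambda>x. \<bar>f x\<bar> powr p"] by blast
  have inc: "\<bar>f t - f s\<bar> \<le> C * (t - s) powr b" if "0 \<le> s" "s \<le> t" for s t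
    unfolding C_def b_def by (rule weak_derivative_increment_closed) fact+
  have bdd: "bdd_above ((\<lambda>t. \<bar>f t\<bar>) ` {0..})"
    using \<open>1 \<le> p\<close> \<open>b > 0\<close> \<open>C \<ge> 0\<close> inc by (intro bounded_from_increment[OF int, of b C]) auto
  let ?K = "sup_norm_factor p f"
  have "?K \<ge> 0" by (simp add: sup_norm_factor_def)
  show "\<bar>f t\<bar> powr p \<le> (1 + p * ?K * C) * tail_integral p f t powr decay_exponent q"
    unfolding exp
  proof (rule decay_from_increment[OF int \<open>t \<ge> 0\<close> _ \<open>b > 0\<close>])
    show "0 \<le> p * ?K * C" using \<open>1 \<le> p\<close> \<open>?K \<ge> 0\<close> \<open>C \<ge> 0\<close> by simp
    fix s
    assume "t \<le> s"
    show "\<bar>f t\<bar> powr p \<le> \<bar>f s\<bar> powr p + p * ?K * C * (s - t) powr b"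
    proof (cases "\<bar>f t\<bar> \<le> \<bar>f s\<bar>")
      case True
      then have "\<bar>f t\<bar> powr p \<le> \<bar>f s\<bar> powr p" using \<open>1 \<le> p\<close> by (intro powr_mono2) auto
      moreover have "0 \<le> p * ?K * C * (s - t) powr b" using \<open>1 \<le> p\<close> \<open>?K \<ge> 0\<close> \<open>C \<ge> 0\<close> by simp
      ultimately show ?thesis by linarith
    next
      case False
      have "\<bar>f t\<bar> \<le> sup_norm f"
        unfolding sup_norm_def using \<open>t \<ge> 0\<close> by (intro cSUP_upper[OF _ bdd]) auto
      then have K: "(if p = 1 then 1 else \<bar>f t\<bar> powr (p - 1)) \<le> ?K"
        using \<open>1 \<le> p\<close> by (auto simp: sup_norm_factor_def intro: powr_mono2)
      have d: "\<bar>f t\<bar> - \<bar>f s\<bar> \<le> C * (s - t) powr b"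
        using inc[OF \<open>t \<ge> 0\<close> \<open>t \<le> s\<close>] by linarith
      \<comment> \<open>The larger value is \<open>\<bar>f t\<bar>\<close>, so the mean value bound
        involves its power, which \<open>K\<close> replaces by the factor with the supremum
        norm.\<close>
      have "\<bar>f t\<bar> powr p - \<bar>f s\<bar> powr p
          \<le> p * (if p = 1 then 1 else \<bar>f t\<bar> powr (p - 1)) * (\<bar>f t\<bar> - \<bar>f s\<bar>)"
        using False \<open>1 \<le> p\<close> by (intro powr_diff_le) auto
      also have "\<dots> \<le> p * ?K * (C * (s - t) powr b)"
        using K d False \<open>1 \<le> p\<close> \<open>?K \<ge> 0\<close> by (intro mult_mono mult_left_mono) auto
      finally show ?thesis by (simp add: mult.assoc)
    qed
  qed
qed

end
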